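(* Let $P(x)=\sum_{i=0}^n P_i x^i\in\mathbb C[x]^{m\times m}$ be a regular matrix polynomial of degree $n$, let $q$ be an integer with $0<q\le n$, and let $B_1(x),\ldots,B_q(x),W_1(x),\ldots,W_q(x)\in\mathbb C[x]^{m\times m}$ be such that $$P(x)=\prod_{i=1}^q B_i(x)+\sum_{i=1}^q W_i(x)\prod_{j=1,\,j\ne i}^q B_j(x),$$ where the $B_i(x)$ are regular, commute with each other, and are pairwise right co-prime. Let $$A(x)=\operatorname{diag}(B_1(x),\ldots,B_q(x))+(e\otimes I_m)[W_1(x),\ldots,W_q(x)],\qquad e=(1,\ldots,1)^t\in\mathbb C^q.$$ Let $\lambda\in\mathbb C$ be such that $\det P(\lambda)=0$ and assume that $\det B_i(\lambda)\ne 0$ for all $i=1,\ldots,q$. If $u_A\in\mathbb C^{mq}$ with $u_A^t=(u_1^t,\ldots,u_q^t)$, $u_i\in\mathbb C^m$, is such that $u_A^tA(\lambda)=0$ and $u_A\ne 0$, then $u^tP(\lambda)=0$, where $u=\sum_{i=1}^q u_i\ne 0$. Conversely, if $u^tP(\lambda)=0$ for a nonzero vector $u\in\mathbb C^m$, then $u_A^tA(\lambda)=0$, where $u_A$ is the nonzero vector with $u_A^t=(u_1^t,\ldots,u_q^t)$ defined by $u_i^t=-u^tW_i(\lambda)B_i(\lambda)^{-1}$ for $i=1,\ldots,q$.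
   Context: $\mathbb C[x]^{m\times m}$ is the set of $m\times m$ matrix polynomials over $\mathbb C$; $P$ has degree $n$ if $P_n\neq 0$. A matrix polynomial is regular if its determinant is not identically zero. Two matrix polynomials $B(x),B'(x)\in\mathbb C[x]^{m\times m}$ are right co-prime if there exist $\alpha(x),\beta(x)\in\mathbb C[x]^{m\times m}$ with $B(x)\alpha(x)+B'(x)\beta(x)=I_m$; "pairwise" refers to all pairs with distinct indices. $\operatorname{diag}(B_1,\ldots,B_q)$ is the block diagonal matrix with these $m\times m$ blocks. The superscript $t$ denotes transpose (no conjugation). *)

theory Defs
  imports
    "Jordan_Normal_Form.Determinant"
    "Jordan_Normal_Form.Gauss_Jordan_Elimination"
    "HOL-Computational_Algebra.Polynomial"
begin

text \<open>
  An m x m matrix polynomial over the complex numbers is an element of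
  \<^term>\<open>carrier_mat m m :: complex poly mat set\<close>, i.e. the polynomial with matrix coefficients
  is represented as a matrix of polynomials.
\<close>

definition matpoly_coeff :: "'a::zero poly mat \<Rightarrow> nat \<Rightarrow> 'a mat" where
  "matpoly_coeff P i = map_mat (\<lambda>p. coeff p i) P"

definition matpoly_has_degree :: "'a::zero poly mat \<Rightarrow> nat \<Rightarrow> bool" where
  "matpoly_has_degree P n \<longleftrightarrow>
     matpoly_coeff P n \<noteq> 0\<^sub>m (dim_row P) (dim_col P) \<and>
     (\<forall>i>n. matpoly_coeff P i = 0\<^sub>m (dim_row P) (dim_col P))"

definition matpoly_eval :: "'a::comm_semiring_0 poly mat \<Rightarrow> 'a \<Rightarrow> 'a mat" where
  "matpoly_eval P x = map_mat (\<lambda>p. poly p x) P"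

definition matpoly_regular :: "'a::comm_ring_1 poly mat \<Rightarrow> bool" where
  "matpoly_regular P \<longleftrightarrow> det P \<noteq> 0"

definition right_coprime :: "nat \<Rightarrow> 'a::comm_semiring_1 poly mat \<Rightarrow> 'a poly mat \<Rightarrow> bool" where
  "right_coprime m B B' \<longleftrightarrow>
     (\<exists>\<alpha> \<in> carrier_mat m m. \<exists>\<beta> \<in> carrier_mat m m. B * \<alpha> + B' * \<beta> = 1\<^sub>m m)"

text \<open>Matrices are not a type-class monoid, so products are the ordered products over lists.\<close>

definition mat_prod_list :: "nat \<Rightarrow> 'a::semiring_1 mat list \<Rightarrow> 'a mat" where
  "mat_prod_list m As = foldr (*) As (1\<^sub>m m)"

definition mat_kronecker :: "'a::times mat \<Rightarrow> 'a mat \<Rightarrow> 'a mat" where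
  "mat_kronecker A B = mat (dim_row A * dim_row B) (dim_col A * dim_col B)
     (\<lambda>(i, j). A $$ (i div dim_row B, j div dim_col B) * B $$ (i mod dim_row B, j mod dim_col B))"

definition append_cols :: "'a::zero mat \<Rightarrow> 'a mat \<Rightarrow> 'a mat" where
  "append_cols A B = four_block_mat A B (0\<^sub>m 0 (dim_col A)) (0\<^sub>m 0 (dim_col B))"

text \<open>The block row \<open>[A\<^sub>1, \<dots>, A\<^sub>k]\<close> of matrices with \<open>m\<close> rows.\<close>

definition block_row :: "nat \<Rightarrow> 'a::zero mat list \<Rightarrow> 'a mat" where
  "block_row m As = foldr append_cols As (0\<^sub>m m 0)"

text \<open>The stacked vector with transpose \<open>(v\<^sub>1\<^sup>t, \<dots>, v\<^sub>k\<^sup>t)\<close>.\<close>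

definition vec_concat :: "'a::zero vec list \<Rightarrow> 'a vec" where
  "vec_concat vs = foldr (@\<^sub>v) vs (0\<^sub>v 0)"

text \<open>\<open>diag(B\<^sub>1, \<dots>, B\<^sub>q) + (e \<otimes> I\<^sub>m) [W\<^sub>1, \<dots>, W\<^sub>q]\<close>, with \<open>e\<close> the all-ones column.\<close>

definition secular_matpoly ::
    "nat \<Rightarrow> nat \<Rightarrow> (nat \<Rightarrow> 'a::comm_ring_1 poly mat) \<Rightarrow> (nat \<Rightarrow> 'a poly mat) \<Rightarrow> 'a poly mat" where
  "secular_matpoly m q B W =
     diag_block_mat (map B [1..<Suc q]) +
     mat_kronecker (mat q 1 (\<lambda>_. 1)) (1\<^sub>m m) * block_row m (map W [1..<Suc q])"

end

theory Submission
  imports Defs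
begin

text \<open>
  Write \<open>B\<^sub>i\<close>, \<open>W\<^sub>i\<close>, \<open>P\<close>, \<open>A\<close> for the values at \<open>\<lambda>\<close> and \<open>Q = B\<^sub>1 \<dots> B\<^sub>q\<close>. Multiplying a row
  \<open>(u\<^sub>1\<^sup>t, \<dots>, u\<^sub>q\<^sup>t)\<close> by \<open>e \<otimes> I\<^sub>m\<close> adds its blocks. Hence \<open>u\<^sub>A\<^sup>t A = 0\<close> is equivalent to the
  block equations
  \<open>u\<^sub>i\<^sup>t B\<^sub>i = - u\<^sup>t W\<^sub>i\<close> for all \<open>i\<close>, where \<open>u = u\<^sub>1 + \<dots> + u\<^sub>q\<close>
  (lemma \<open>row_mult_secular_eq_zero_iff\<close>).

  Now let \<open>u\<close> be any vector, and suppose that rows \<open>v\<^sub>i\<close> satisfy \<open>v\<^sub>i\<^sup>t B\<^sub>i = - u\<^sup>t W\<^sub>i\<close>. Since the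
  \<open>B\<^sub>i\<close> commute, \<open>B\<^sub>i\<close> times the product of the other \<open>B\<^sub>j\<close> is \<open>Q\<close>, and so each summand
  \<open>u\<^sup>t W\<^sub>i \<Prod>\<^sub>j\<^sub>\<noteq>\<^sub>i B\<^sub>j\<close> of \<open>u\<^sup>t P\<close> equals \<open>- v\<^sub>i\<^sup>t Q\<close>. Therefore
  \<open>u\<^sup>t P = (u - (v\<^sub>1 + \<dots> + v\<^sub>q))\<^sup>t Q\<close> (lemma \<open>row_mult_interpolation\<close>).

  Both directions follow, as \<open>Q\<close> and all \<open>B\<^sub>i\<close> are invertible. If \<open>u\<^sub>A\<^sup>t A = 0\<close>, the identity applies
  with \<open>v\<^sub>i = u\<^sub>i\<close> and gives \<open>u\<^sup>t P = 0\<close>; were \<open>u\<close> zero, the block equations would force every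
  \<open>u\<^sub>i\<close> to vanish. Conversely, the prescribed \<open>u\<^sub>i\<close> solve \<open>u\<^sub>i\<^sup>t B\<^sub>i = - u\<^sup>t W\<^sub>i\<close> by construction; if
  \<open>u\<^sup>t P = 0\<close>, the identity shows that their sum is \<open>u\<close>. So these equations are the block
  equations of \<open>u\<^sub>A\<close>, and \<open>u\<^sub>A \<noteq> 0\<close> because \<open>u \<noteq> 0\<close>.
\<close>

section \<open>Row vectors and block matrices\<close>

lemma mat_of_row_zero_iff:
  assumes "v \<in> carrier_vec k"
  shows "mat_of_row v = 0\<^sub>m 1 k \<longleftrightarrow> v = 0\<^sub>v k"
proof
  assume "mat_of_row v = 0\<^sub>m 1 k"
  from arg_cong[OF this, of "\<lambda>M. row M 0"] show "v = 0\<^sub>v k" by simp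
qed (auto simp: mat_of_row_def)

lemma mat_of_row_add:
  assumes "u \<in> carrier_vec k" "v \<in> carrier_vec k"
  shows "mat_of_row (u + v) = mat_of_row u + mat_of_row v"
  using assms by (intro eq_matI) (auto simp: mat_of_row_def)

lemma mat_of_row_row:
  assumes "A \<in> carrier_mat 1 k"
  shows "mat_of_row (row A 0) = A"
  using assms by (intro eq_matI) (auto simp: mat_of_row_def)

lemma add_eq_zero_mat_iff:
  fixes A X :: "'a::ab_group_add mat"
  assumes "A \<in> carrier_mat k l" "X \<in> carrier_mat k l"
  shows "A + X = 0\<^sub>m k l \<longleftrightarrow> A = - X"
  using assms by (auto simp: mat_eq_iff add_eq_0_iff2)

lemma vec_concat_carrier:
  assumes "\<And>i. i \<in> set xs \<Longrightarrow> v i \<in> carrier_vec m"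
  shows "vec_concat (map v xs) \<in> carrier_vec (m * length xs)"
  using assms
proof (induction xs)
  case (Cons x xs)
  then have "v x \<in> carrier_vec m" "vec_concat (map v xs) \<in> carrier_vec (m * length xs)" by auto
  then show ?case unfolding vec_concat_def by simp
qed (simp add: vec_concat_def)

lemma vec_concat_zero:
  assumes "\<And>i. i \<in> set xs \<Longrightarrow> v i = 0\<^sub>v m"
  shows "vec_concat (map v xs) = 0\<^sub>v (m * length xs)"
  using assms
proof (induction xs)
  case (Cons x xs)
  then show ?case unfolding vec_concat_def by (auto intro!: eq_vecI)
qed (simp add: vec_concat_def)

lemma block_row_carrier:
  assumes "\<And>i. i \<in> set xs \<Longrightarrow> A i \<in> carrier_mat r m"
  shows "block_row r (map A xs) \<in> carrier_mat r (m * length xs)"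
  using assms
proof (induction xs)
  case (Cons x xs)
  then have "A x \<in> carrier_mat r m" "block_row r (map A xs) \<in> carrier_mat r (m * length xs)"
    by auto
  then show ?case unfolding block_row_def append_cols_def by auto
qed (simp add: block_row_def)

lemma diag_block_carrier:
  assumes "\<And>i. i \<in> set xs \<Longrightarrow> A i \<in> carrier_mat m m"
  shows "diag_block_mat (map A xs) \<in> carrier_mat (m * length xs) (m * length xs)"
  using assms
proof (induction xs)
  case (Cons x xs)
  then have "A x \<in> carrier_mat m m"
    "diag_block_mat (map A xs) \<in> carrier_mat (m * length xs) (m * length xs)" by auto
  then show ?case by (auto simp: Let_def)
qed simp

lemma block_row_add:
  fixes A C :: "'b \<Rightarrow> 'a::monoid_add mat"
  assumes "\<And>i. i \<in> set xs \<Longrightarrow> A i \<in> carrier_mat r m" "\<And>i. i \<in> set xs \<Longrightarrow> C i \<in> carrier_mat r m"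
  shows "block_row r (map A xs) + block_row r (map C xs) = block_row r (map (\<lambda>i. A i + C i) xs)"
  using assms
proof (induction xs)
  case (Cons x xs)
  from Cons have IH: "block_row r (map A xs) + block_row r (map C xs) =
      block_row r (map (\<lambda>i. A i + C i) xs)" by auto
  have c: "A x \<in> carrier_mat r m" "C x \<in> carrier_mat r m"
    "block_row r (map A xs) \<in> carrier_mat r (m * length xs)"
    "block_row r (map C xs) \<in> carrier_mat r (m * length xs)"
    using Cons by (auto intro!: block_row_carrier)
  have "append_cols (A x) (block_row r (map A xs)) + append_cols (C x) (block_row r (map C xs)) =
      append_cols (A x + C x) (block_row r (map A xs) + block_row r (map C xs))"
    unfolding append_cols_def using c
    by (subst add_four_block_mat[OF c(1) c(3) _ _ c(2) c(4)]) auto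
  then show ?case using IH by (simp add: block_row_def)
qed (simp add: block_row_def)

lemma block_row_eq_zero_iff:
  assumes "\<And>i. i \<in> set xs \<Longrightarrow> A i \<in> carrier_mat r m"
  shows "block_row r (map A xs) = 0\<^sub>m r (m * length xs) \<longleftrightarrow> (\<forall>i\<in>set xs. A i = 0\<^sub>m r m)"
  using assms
proof (induction xs)
  case (Cons x xs)
  let ?R = "block_row r (map A xs)"
  have c: "A x \<in> carrier_mat r m" "?R \<in> carrier_mat r (m * length xs)"
    using Cons by (auto intro!: block_row_carrier)
  have "append_cols (A x) ?R = 0\<^sub>m r (m * length (x # xs)) \<longleftrightarrow>
      A x = 0\<^sub>m r m \<and> ?R = 0\<^sub>m r (m * length xs)"
  proof
    assume 0: "append_cols (A x) ?R = 0\<^sub>m r (m * length (x # xs))"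
    have entry: "append_cols (A x) ?R $$ (i, j) = 0" if "i < r" "j < m + m * length xs" for i j
      using 0 that by simp
    have "A x $$ (i, j) = 0" if "i < r" "j < m" for i j
      using entry[of i j] that c by (simp add: append_cols_def)
    moreover have "?R $$ (i, j) = 0" if "i < r" "j < m * length xs" for i j
      using entry[of i "m + j"] that c by (simp add: append_cols_def)
    ultimately show "A x = 0\<^sub>m r m \<and> ?R = 0\<^sub>m r (m * length xs)"
      using c by (auto simp: mat_eq_iff)
  qed (auto simp: append_cols_def)
  then show ?case using Cons by (simp add: block_row_def)
qed (simp add: block_row_def)

text \<open>
  Appending an empty second column to \<open>C\<close> and an empty second row to the block row turns
  \<open>C * [W\<^sub>1, W']\<close> into a product of two-by-two block matrices, so that the rule for
  multiplying those applies.
\<close>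

lemma mult_block_row:
  fixes C :: "'a::semiring_0 mat"
  assumes C: "C \<in> carrier_mat r m" and "\<And>i. i \<in> set xs \<Longrightarrow> W i \<in> carrier_mat m k"
  shows "C * block_row m (map W xs) = block_row r (map (\<lambda>i. C * W i) xs)"
  using assms(2)
proof (induction xs)
  case (Cons x xs)
  have c: "W x \<in> carrier_mat m k" "block_row m (map W xs) \<in> carrier_mat m (k * length xs)"
    using Cons by (auto intro!: block_row_carrier)
  let ?R = "block_row m (map W xs)" and ?Z = "\<lambda>l. 0\<^sub>m 0 l :: 'a mat"
  have C_block: "four_block_mat C (0\<^sub>m r 0) (?Z m) (?Z 0) = C"
    using C by (intro eq_matI) auto
  have dims: "dim_col (W x) = k" "dim_col ?R = k * length xs"
    "dim_col (C * W x) = k" "dim_col (C * ?R) = k * length xs"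
    using C c by auto
  have "four_block_mat C (0\<^sub>m r 0) (?Z m) (?Z 0) *
      four_block_mat (W x) ?R (?Z k) (?Z (k * length xs)) =
      four_block_mat (C * W x) (C * ?R) (?Z k) (?Z (k * length xs))"
    using C c by (subst mult_four_block_mat[OF C zero_carrier_mat zero_carrier_mat zero_carrier_mat
          c zero_carrier_mat zero_carrier_mat]) (auto intro!: cong_four_block_mat)
  then have "C * append_cols (W x) ?R = append_cols (C * W x) (C * ?R)"
    unfolding C_block append_cols_def dims .
  then show ?case using Cons by (simp add: block_row_def)
qed (use right_mult_zero_mat[OF C] in \<open>simp add: block_row_def\<close>)

lemma mat_of_row_append_vec:
  "mat_of_row (v @\<^sub>v w) = append_cols (mat_of_row v) (mat_of_row w)"
  unfolding append_cols_def by (intro eq_matI) (auto simp: mat_of_row_def)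

section \<open>Left multiplication of the secular matrix\<close>

lemma row_mult_diag_block:
  fixes v :: "'b \<Rightarrow> 'a::semiring_1 vec"
  assumes "\<And>i. i \<in> set xs \<Longrightarrow> v i \<in> carrier_vec m"
    and "\<And>i. i \<in> set xs \<Longrightarrow> A i \<in> carrier_mat m m"
  shows "mat_of_row (vec_concat (map v xs)) * diag_block_mat (map A xs) =
    block_row 1 (map (\<lambda>i. mat_of_row (v i) * A i) xs)"
  using assms
proof (induction xs)
  case (Cons x xs)
  let ?k = "m * length xs"
  let ?v = "vec_concat (map v xs)" and ?D = "diag_block_mat (map A xs)"
  from Cons have c: "v x \<in> carrier_vec m" "?v \<in> carrier_vec ?k"
    "A x \<in> carrier_mat m m" "?D \<in> carrier_mat ?k ?k"
    by (auto intro!: vec_concat_carrier diag_block_carrier)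
  have r: "mat_of_row (v x) \<in> carrier_mat 1 m" "mat_of_row ?v \<in> carrier_mat 1 ?k"
    using c by auto
  have dims: "dim_col (mat_of_row (v x)) = m" "dim_col (mat_of_row ?v) = ?k"
    "dim_col (mat_of_row (v x) * A x) = m" "dim_col (mat_of_row ?v * ?D) = ?k"
    using c by auto
  have mult: "mat_of_row (v x @\<^sub>v ?v) * four_block_mat (A x) (0\<^sub>m m ?k) (0\<^sub>m ?k m) ?D =
      append_cols (mat_of_row (v x) * A x) (mat_of_row ?v * ?D)"
    unfolding mat_of_row_append_vec append_cols_def dims using c r
    by (subst mult_four_block_mat[OF r zero_carrier_mat zero_carrier_mat c(3)
          zero_carrier_mat zero_carrier_mat c(4)]) (auto intro!: cong_four_block_mat)
  have IH: "mat_of_row ?v * ?D = block_row 1 (map (\<lambda>i. mat_of_row (v i) * A i) xs)"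
    by (rule Cons.IH) (use Cons.prems in auto)
  have V: "vec_concat (map v (x # xs)) = v x @\<^sub>v ?v" by (simp add: vec_concat_def)
  have D: "diag_block_mat (map A (x # xs)) =
      four_block_mat (A x) (0\<^sub>m m ?k) (0\<^sub>m ?k m) ?D"
    using carrier_matD[OF c(3)] carrier_matD[OF c(4)] by (simp add: Let_def)
  have R: "block_row 1 (map (\<lambda>i. mat_of_row (v i) * A i) (x # xs)) =
      append_cols (mat_of_row (v x) * A x) (block_row 1 (map (\<lambda>i. mat_of_row (v i) * A i) xs))"
    by (simp add: block_row_def)
  show ?case unfolding V D mult R IH ..
qed (auto simp: block_row_def vec_concat_def)

text \<open>
  The recursion for multiplying by \<open>e \<otimes> I\<^sub>m\<close>: this matrix is a stack of copies of the identity,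
  and one more entry of \<open>e\<close> adds one more copy on top.
\<close>

lemma kronecker_ones_Suc:
  fixes m k :: nat
  defines "E \<equiv> \<lambda>k. mat_kronecker (mat k 1 (\<lambda>_. 1)) (1\<^sub>m m :: 'a::semiring_1 mat)"
  shows "E (Suc k) = 1\<^sub>m m @\<^sub>r E k"
proof (rule eq_matI)
  fix i j
  assume "i < dim_row (1\<^sub>m m @\<^sub>r E k)" "j < dim_col (1\<^sub>m m @\<^sub>r E k)"
  then have b: "i < m + k * m" "j < m"
    by (auto simp: append_rows_def E_def mat_kronecker_def)
  then have "m > 0" by simp
  have "i div m < Suc k" "\<not> i < m \<Longrightarrow> (i - m) div m < k"
    using b \<open>m > 0\<close> by (auto simp: less_mult_imp_div_less)
  moreover have "\<not> i < m \<Longrightarrow> (i - m) mod m = i mod m"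
    by (simp add: le_mod_geq)
  ultimately show "E (Suc k) $$ (i, j) = (1\<^sub>m m @\<^sub>r E k) $$ (i, j)"
    using b \<open>m > 0\<close> by (cases "i < m") (simp_all add: append_rows_def E_def mat_kronecker_def)
qed (auto simp: append_rows_def E_def mat_kronecker_def)

lemma kronecker_ones_carrier:
  "mat_kronecker (mat k 1 (\<lambda>_. 1)) (1\<^sub>m m :: 'a::semiring_1 mat) \<in> carrier_mat (m * k) m"
  by (rule carrier_matI) (simp_all add: mat_kronecker_def)

text \<open>
  This is where the vector \<open>u = u\<^sub>1 + \<dots> + u\<^sub>q\<close> comes from: multiplication by a stack of identity
  matrices adds the blocks of a row.
\<close>

lemma row_mult_kronecker_ones:
  fixes v :: "'b \<Rightarrow> 'a::semiring_1 vec"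
  assumes "distinct xs" and "\<And>i. i \<in> set xs \<Longrightarrow> v i \<in> carrier_vec m"
  shows "mat_of_row (vec_concat (map v xs)) *
      mat_kronecker (mat (length xs) 1 (\<lambda>_. 1)) (1\<^sub>m m) =
    mat_of_row (finsum_vec TYPE('a) m v (set xs))"
  using assms
proof (induction xs)
  case Nil
  show ?case
    by (auto simp: vec_concat_def finsum_vec_empty mat_kronecker_def mat_of_row_def scalar_prod_def)
next
  case (Cons x xs)
  let ?v = "vec_concat (map v xs)" and ?s = "finsum_vec TYPE('a) m v (set xs)"
  let ?E = "mat_kronecker (mat (length xs) 1 (\<lambda>_. 1)) (1\<^sub>m m) :: 'a mat"
  have c: "v x \<in> carrier_vec m" "?v \<in> carrier_vec (m * length xs)" "?s \<in> carrier_vec m"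
    using Cons.prems by (auto intro!: vec_concat_carrier finsum_vec_closed)
  have s: "finsum_vec TYPE('a) m v (set (x # xs)) = v x + ?s"
    using Cons.prems by (auto intro!: finsum_vec_insert)
  have IH: "mat_of_row ?v * ?E = mat_of_row ?s" using Cons by auto
  have "mat_of_row (v x @\<^sub>v ?v) * (1\<^sub>m m @\<^sub>r ?E) =
      mat_of_row (v x) * 1\<^sub>m m + mat_of_row ?v * ?E"
    by (rule mat_of_row_mult_append_rows[OF c(1,2) one_carrier_mat kronecker_ones_carrier])
  also have "\<dots> = mat_of_row (v x + ?s)"
    unfolding IH mat_of_row_add[OF c(1,3)] using c by (simp add: right_mult_one_mat[of _ 1])
  finally have *: "mat_of_row (v x @\<^sub>v ?v) * (1\<^sub>m m @\<^sub>r ?E) = mat_of_row (v x + ?s)" .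
  have E: "mat_kronecker (mat (length (x # xs)) 1 (\<lambda>_. 1)) (1\<^sub>m m) = (1\<^sub>m m @\<^sub>r ?E)"
    by (simp only: length_Cons kronecker_ones_Suc)
  have V: "vec_concat (map v (x # xs)) = v x @\<^sub>v ?v" by (simp add: vec_concat_def)
  show ?case by (simp only: E V s *)
qed

lemma row_mult_secular:
  fixes v :: "nat \<Rightarrow> 'a::comm_ring_1 vec"
  assumes "distinct xs"
    and v: "\<And>i. i \<in> set xs \<Longrightarrow> v i \<in> carrier_vec m"
    and B: "\<And>i. i \<in> set xs \<Longrightarrow> B i \<in> carrier_mat m m"
    and W: "\<And>i. i \<in> set xs \<Longrightarrow> W i \<in> carrier_mat m m"
  defines "u \<equiv> finsum_vec TYPE('a) m v (set xs)"
  shows "mat_of_row (vec_concat (map v xs)) * (diag_block_mat (map B xs) +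
      mat_kronecker (mat (length xs) 1 (\<lambda>_. 1)) (1\<^sub>m m) * block_row m (map W xs)) =
    block_row 1 (map (\<lambda>i. mat_of_row (v i) * B i + mat_of_row u * W i) xs)"
proof -
  let ?k = "m * length xs"
  let ?V = "mat_of_row (vec_concat (map v xs))" and ?D = "diag_block_mat (map B xs)"
  let ?E = "mat_kronecker (mat (length xs) 1 (\<lambda>_. 1)) (1\<^sub>m m) :: 'a mat"
  let ?R = "block_row m (map W xs)"
  have V: "?V \<in> carrier_mat 1 ?k" using vec_concat_carrier[of xs v m] v by auto
  have D: "?D \<in> carrier_mat ?k ?k" by (rule diag_block_carrier) (rule B)
  have E: "?E \<in> carrier_mat ?k m" by (rule kronecker_ones_carrier)
  have R: "?R \<in> carrier_mat m ?k" by (rule block_row_carrier) (rule W)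
  have u: "u \<in> carrier_vec m" unfolding u_def using v by (auto intro!: finsum_vec_closed)
  have U: "mat_of_row u \<in> carrier_mat 1 m" using u by auto
  have "?V * (?D + ?E * ?R) = ?V * ?D + ?V * ?E * ?R"
    using V D E R by (simp add: mult_add_distrib_mat[OF V D] assoc_mult_mat[OF V E R])
  also have "?V * ?E = mat_of_row u"
    unfolding u_def by (rule row_mult_kronecker_ones) (use assms(1) v in auto)
  also have "mat_of_row u * ?R = block_row 1 (map (\<lambda>i. mat_of_row u * W i) xs)"
    by (rule mult_block_row[OF U]) (rule W)
  also have "?V * ?D = block_row 1 (map (\<lambda>i. mat_of_row (v i) * B i) xs)"
    by (rule row_mult_diag_block) (use v B in auto)
  also have "\<dots> + block_row 1 (map (\<lambda>i. mat_of_row u * W i) xs) =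
      block_row 1 (map (\<lambda>i. mat_of_row (v i) * B i + mat_of_row u * W i) xs)"
    using v B W U by (intro block_row_add[where m = m] mult_carrier_mat[where n = m]) auto
  finally show ?thesis .
qed

text \<open>
  The large eigenvector equation decouples: its \<open>i\<close>-th block is \<open>u\<^sub>i\<^sup>t B\<^sub>i + u\<^sup>t W\<^sub>i\<close>, and the blocks
  interact only through the sum \<open>u\<close>. In both directions of the theorem the block equations
  replace the equation for the \<open>mq \<times> mq\<close> matrix.
\<close>

lemma row_mult_secular_eq_zero_iff:
  fixes v :: "nat \<Rightarrow> 'a::comm_ring_1 vec"
  assumes "distinct xs"
    and v: "\<And>i. i \<in> set xs \<Longrightarrow> v i \<in> carrier_vec m"
    and B: "\<And>i. i \<in> set xs \<Longrightarrow> B i \<in> carrier_mat m m"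
    and W: "\<And>i. i \<in> set xs \<Longrightarrow> W i \<in> carrier_mat m m"
  defines "u \<equiv> finsum_vec TYPE('a) m v (set xs)"
  shows "mat_of_row (vec_concat (map v xs)) * (diag_block_mat (map B xs) +
      mat_kronecker (mat (length xs) 1 (\<lambda>_. 1)) (1\<^sub>m m) * block_row m (map W xs)) =
      0\<^sub>m 1 (m * length xs) \<longleftrightarrow>
    (\<forall>i\<in>set xs. mat_of_row (v i) * B i = - (mat_of_row u * W i))"
proof -
  have "u \<in> carrier_vec m" unfolding u_def using v by (auto intro!: finsum_vec_closed)
  then have U: "mat_of_row u \<in> carrier_mat 1 m" by auto
  have BW: "mat_of_row (v i) * B i \<in> carrier_mat 1 m" "mat_of_row u * W i \<in> carrier_mat 1 m"
    if "i \<in> set xs" for i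
    using that v B W U by (auto intro!: mult_carrier_mat[where n = m])
  have "mat_of_row (vec_concat (map v xs)) * (diag_block_mat (map B xs) +
      mat_kronecker (mat (length xs) 1 (\<lambda>_. 1)) (1\<^sub>m m) * block_row m (map W xs)) =
    block_row 1 (map (\<lambda>i. mat_of_row (v i) * B i + mat_of_row u * W i) xs)"
    unfolding u_def by (rule row_mult_secular) (use assms(1) v B W in auto)
  moreover have "block_row 1 (map (\<lambda>i. mat_of_row (v i) * B i + mat_of_row u * W i) xs) =
      0\<^sub>m 1 (m * length xs) \<longleftrightarrow>
    (\<forall>i\<in>set xs. mat_of_row (v i) * B i + mat_of_row u * W i = 0\<^sub>m 1 m)"
    by (rule block_row_eq_zero_iff) (intro add_carrier_mat BW)
  moreover have "\<dots> \<longleftrightarrow> (\<forall>i\<in>set xs. mat_of_row (v i) * B i = - (mat_of_row u * W i))"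
    by (intro ball_cong refl add_eq_zero_mat_iff BW)
  ultimately show ?thesis by (simp only:)
qed

section \<open>Left multiplication of the interpolation formula\<close>

lemma mat_prod_list_carrier:
  assumes "\<And>i. i \<in> set xs \<Longrightarrow> B i \<in> carrier_mat m m"
  shows "mat_prod_list m (map B xs) \<in> carrier_mat m m"
  using assms
  by (induction xs) (auto simp: mat_prod_list_def intro!: mult_carrier_mat[of _ m m])

lemma det_mat_prod_list:
  fixes B :: "'b \<Rightarrow> 'a::comm_ring_1 mat"
  assumes "\<And>i. i \<in> set xs \<Longrightarrow> B i \<in> carrier_mat m m"
  shows "det (mat_prod_list m (map B xs)) = (\<Prod>i\<leftarrow>xs. det (B i))"
  using assms
proof (induction xs)
  case (Cons x xs)
  then have "B x \<in> carrier_mat m m" "mat_prod_list m (map B xs) \<in> carrier_mat m m"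
    by (auto intro!: mat_prod_list_carrier)
  from det_mult[OF this] show ?case using Cons by (simp add: mat_prod_list_def)
qed (simp add: mat_prod_list_def)

text \<open>
  The factor \<open>B i\<close> commutes past the factors to its left, one at a time, until it stands in front.
\<close>

lemma mat_prod_list_extract:
  fixes B :: "'b \<Rightarrow> 'a::comm_ring_1 mat"
  assumes "\<And>j. j \<in> set xs \<Longrightarrow> B j \<in> carrier_mat m m"
    and "\<And>j. j \<in> set xs \<Longrightarrow> B i * B j = B j * B i"
    and "i \<in> set xs"
  shows "mat_prod_list m (map B xs) = B i * mat_prod_list m (map B (remove1 i xs))"
  using assms
proof (induction xs)
  case (Cons x xs)
  show ?case
  proof (cases "x = i")
    case False
    let ?R = "mat_prod_list m (map B (remove1 i xs))"
    have c: "B x \<in> carrier_mat m m" "B i \<in> carrier_mat m m" using Cons.prems by auto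
    have R: "?R \<in> carrier_mat m m"
      by (rule mat_prod_list_carrier) (use Cons.prems(1) set_remove1_subset[of i xs] in auto)
    have "mat_prod_list m (map B (x # xs)) = B x * (B i * ?R)"
      using Cons False by (auto simp: mat_prod_list_def)
    also have "\<dots> = B x * B i * ?R" by (simp add: assoc_mult_mat[OF c R])
    also have "B x * B i = B i * B x" using Cons.prems by simp
    also have "\<dots> * ?R = B i * (B x * ?R)" by (rule assoc_mult_mat[OF c(2,1) R])
    finally show ?thesis using False by (simp add: mat_prod_list_def)
  qed (simp add: mat_prod_list_def)
qed simp

text \<open>
  Each summand is rewritten by its block equation,
  \<open>u\<^sup>t W\<^sub>i C\<^sub>i = - v\<^sub>i\<^sup>t B\<^sub>i C\<^sub>i = - v\<^sub>i\<^sup>t Q\<close>. In the application \<open>C\<^sub>i\<close> is the product of the \<open>B\<^sub>j\<close> with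
  \<open>j \<noteq> i\<close>, so that all the products \<open>B\<^sub>i C\<^sub>i\<close> are the same matrix \<open>Q\<close>.
\<close>

lemma row_mult_interpolation_sum:
  fixes B W C :: "'b \<Rightarrow> 'a::comm_ring_1 mat"
  assumes "finite F" and u: "u \<in> carrier_vec m"
    and v: "v \<in> F \<rightarrow> carrier_vec m"
    and B: "\<And>i. i \<in> F \<Longrightarrow> B i \<in> carrier_mat m m"
    and W: "\<And>i. i \<in> F \<Longrightarrow> W i \<in> carrier_mat m m"
    and C: "\<And>i. i \<in> F \<Longrightarrow> C i \<in> carrier_mat m m"
    and Q: "Q \<in> carrier_mat m m" "\<And>i. i \<in> F \<Longrightarrow> B i * C i = Q"
    and eq: "\<And>i. i \<in> F \<Longrightarrow> mat_of_row (v i) * B i = - (mat_of_row u * W i)"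
  shows "mat_of_row u * (\<Oplus>\<^bsub>ring_mat TYPE('a) m ()\<^esub>i\<in>F. W i * C i) =
    - (mat_of_row (finsum_vec TYPE('a) m v F) * Q)"
  using assms(1) v B W C Q(2) eq
proof (induction F)
  case empty
  interpret M: ring "ring_mat TYPE('a) m ()" by (rule ring_mat)
  show ?case using u Q(1) by (auto simp: ring_mat_simps finsum_vec_empty mat_eq_iff)
next
  case (insert x F)
  interpret M: ring "ring_mat TYPE('a) m ()" by (rule ring_mat)
  let ?S = "\<Oplus>\<^bsub>ring_mat TYPE('a) m ()\<^esub>i\<in>F. W i * C i"
  let ?s = "finsum_vec TYPE('a) m v F"
  have WC: "(\<lambda>i. W i * C i) \<in> F \<rightarrow> carrier (ring_mat TYPE('a) m ())"
    "W x * C x \<in> carrier (ring_mat TYPE('a) m ())"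
    using insert.prems(3,4) by (auto simp: ring_mat_simps intro!: mult_carrier_mat[of _ m m])
  have S: "?S \<in> carrier_mat m m" using M.finsum_closed[OF WC(1)] by (simp add: ring_mat_simps)
  have c: "v x \<in> carrier_vec m" "?s \<in> carrier_vec m"
    "B x \<in> carrier_mat m m" "W x \<in> carrier_mat m m" "C x \<in> carrier_mat m m"
    using insert.prems by (auto intro!: finsum_vec_closed)
  have r: "mat_of_row u \<in> carrier_mat 1 m" "mat_of_row (v x) \<in> carrier_mat 1 m"
    "mat_of_row ?s \<in> carrier_mat 1 m"
    using u c by auto
  have IH: "mat_of_row u * ?S = - (mat_of_row ?s * Q)"
    using insert.prems by (intro insert.IH) auto
  have "mat_of_row u * (W x * C x) = mat_of_row u * W x * C x"
    by (rule assoc_mult_mat[OF r(1) c(4,5), symmetric])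
  also have "mat_of_row u * W x = - (mat_of_row (v x) * B x)"
    using insert.prems(6)[of x] c r by simp
  also have "\<dots> * C x = - (mat_of_row (v x) * Q)"
  proof -
    have "- (mat_of_row (v x) * B x) * C x = - (mat_of_row (v x) * B x * C x)"
      using r(2) c(3,5) by (intro uminus_mult_left_mat) auto
    then show ?thesis
      unfolding assoc_mult_mat[OF r(2) c(3,5)] insert.prems(5)[OF insertI1] .
  qed
  finally have x: "mat_of_row u * (W x * C x) = - (mat_of_row (v x) * Q)" .
  have "(\<Oplus>\<^bsub>ring_mat TYPE('a) m ()\<^esub>i\<in>insert x F. W i * C i) = W x * C x + ?S"
    using M.finsum_insert[OF insert.hyps WC] by (simp add: ring_mat_simps)
  then have "mat_of_row u * (\<Oplus>\<^bsub>ring_mat TYPE('a) m ()\<^esub>i\<in>insert x F. W i * C i) =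
      mat_of_row u * (W x * C x) + mat_of_row u * ?S"
    using mult_add_distrib_mat[OF r(1) mult_carrier_mat[OF c(4,5)] S] by simp
  also have "\<dots> = - ((mat_of_row (v x) + mat_of_row ?s) * Q)"
    unfolding x IH add_mult_distrib_mat[OF r(2,3) Q(1)]
    using r Q(1) by (auto simp: mat_eq_iff)
  also have "mat_of_row (v x) + mat_of_row ?s = mat_of_row (v x + ?s)"
    by (rule mat_of_row_add[OF c(1,2), symmetric])
  also have "v x + ?s = finsum_vec TYPE('a) m v (insert x F)"
    using insert by (intro finsum_vec_insert[symmetric]) auto
  finally show ?case .
qed

text \<open>
  The identity on which both directions of the theorem rest: given the block equations for some
  rows \<open>v\<^sub>i\<close>, the row \<open>u\<^sup>t P\<close> measures exactly how far \<open>u\<close> is from the sum of the \<open>v\<^sub>i\<close>, up to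
  the factor \<open>B\<^sub>1 \<dots> B\<^sub>q\<close>. Here \<open>u\<close> need not be that sum:
  the converse direction derives their equality from this identity.
\<close>

lemma row_mult_interpolation:
  fixes B W :: "'b \<Rightarrow> 'a::comm_ring_1 mat"
  assumes "distinct xs" and u: "u \<in> carrier_vec m"
    and v: "\<And>i. i \<in> set xs \<Longrightarrow> v i \<in> carrier_vec m"
    and B: "\<And>i. i \<in> set xs \<Longrightarrow> B i \<in> carrier_mat m m"
    and W: "\<And>i. i \<in> set xs \<Longrightarrow> W i \<in> carrier_mat m m"
    and comm: "\<And>i j. i \<in> set xs \<Longrightarrow> j \<in> set xs \<Longrightarrow> B i * B j = B j * B i"
    and eq: "\<And>i. i \<in> set xs \<Longrightarrow> mat_of_row (v i) * B i = - (mat_of_row u * W i)"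
  shows "mat_of_row u * (mat_prod_list m (map B xs) +
      (\<Oplus>\<^bsub>ring_mat TYPE('a) m ()\<^esub>i\<in>set xs.
        W i * mat_prod_list m (map B (filter (\<lambda>j. j \<noteq> i) xs)))) =
    mat_of_row (u - finsum_vec TYPE('a) m v (set xs)) * mat_prod_list m (map B xs)"
proof -
  interpret M: ring "ring_mat TYPE('a) m ()" by (rule ring_mat)
  let ?Q = "mat_prod_list m (map B xs)"
  let ?C = "\<lambda>i. mat_prod_list m (map B (filter (\<lambda>j. j \<noteq> i) xs))"
  let ?S = "\<Oplus>\<^bsub>ring_mat TYPE('a) m ()\<^esub>i\<in>set xs. W i * ?C i"
  let ?s = "finsum_vec TYPE('a) m v (set xs)"
  have Q: "?Q \<in> carrier_mat m m" by (rule mat_prod_list_carrier) (rule B)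
  have C: "?C i \<in> carrier_mat m m" for i by (rule mat_prod_list_carrier) (use B in auto)
  have BC: "B i * ?C i = ?Q" if "i \<in> set xs" for i
  proof -
    have "filter (\<lambda>j. j \<noteq> i) xs = remove1 i xs"
      using \<open>distinct xs\<close> by (simp add: distinct_remove1_removeAll removeAll_filter_not_eq eq_commute)
    then show ?thesis using mat_prod_list_extract[of xs B m i] B comm that by simp
  qed
  have S: "?S \<in> carrier_mat m m"
    using M.finsum_closed[of "\<lambda>i. W i * ?C i" "set xs"] mult_carrier_mat[OF W C]
    by (auto simp: ring_mat_simps)
  have s: "?s \<in> carrier_vec m" using v by (auto intro!: finsum_vec_closed)
  have r: "mat_of_row u \<in> carrier_mat 1 m" "mat_of_row ?s \<in> carrier_mat 1 m"
    using u s by auto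
  have "mat_of_row u * (?Q + ?S) = mat_of_row u * ?Q + mat_of_row u * ?S"
    by (rule mult_add_distrib_mat[OF r(1) Q S])
  also have "mat_of_row u * ?S = - (mat_of_row ?s * ?Q)"
    by (rule row_mult_interpolation_sum[where B = B]) (use u v B W C Q BC eq in auto)
  also have "mat_of_row u * ?Q + - (mat_of_row ?s * ?Q) = (mat_of_row u - mat_of_row ?s) * ?Q"
    unfolding minus_mult_distrib_mat[OF r Q] using r Q by (auto simp: mat_eq_iff)
  also have "mat_of_row u - mat_of_row ?s = mat_of_row (u - ?s)"
    using u s by (auto simp: mat_eq_iff mat_of_row_def)
  finally show ?thesis .
qed

section \<open>Matrices with nonzero determinant\<close>

lemma mat_inverse_det:
  fixes A :: "'a::field mat"
  assumes A: "A \<in> carrier_mat m m" and "det A \<noteq> 0"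
  shows "A * the (mat_inverse A) = 1\<^sub>m m" "the (mat_inverse A) * A = 1\<^sub>m m"
    "the (mat_inverse A) \<in> carrier_mat m m"
proof -
  obtain X where "mat_inverse A = Some X"
    using mat_inverse(1)[OF A, of "()"] det_non_zero_imp_unit[OF A assms(2), of "()"]
    by (cases "mat_inverse A") auto
  then show "A * the (mat_inverse A) = 1\<^sub>m m" "the (mat_inverse A) * A = 1\<^sub>m m"
    "the (mat_inverse A) \<in> carrier_mat m m"
    using mat_inverse(2)[OF A] by auto
qed

lemma mult_mat_eq_zero_det:
  fixes A :: "'a::field mat"
  assumes A: "A \<in> carrier_mat m m" and "det A \<noteq> 0"
    and X: "X \<in> carrier_mat k m" and "X * A = 0\<^sub>m k m"
  shows "X = 0\<^sub>m k m"
proof -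
  note inv = mat_inverse_det[OF A assms(2)]
  have "X = X * A * the (mat_inverse A)"
    using X inv(1) by (simp add: assoc_mult_mat[OF X A inv(3)])
  then show ?thesis using assms(4) inv(3) by simp
qed

section \<open>Evaluation of matrix polynomials\<close>

text \<open>
  The theorem concerns only the values of the matrix polynomials at one point. Evaluation at a
  point is a ring homomorphism on the entries, so it commutes with every construction occurring
  in the interpolation formula and in the secular matrix.
\<close>

lemma matpoly_eval_carrier [simp]:
  "matpoly_eval A x \<in> carrier_mat k l \<longleftrightarrow> A \<in> carrier_mat k l"
  by (simp add: matpoly_eval_def)

lemma matpoly_eval_simps [simp]:
  "dim_row (matpoly_eval A x) = dim_row A" "dim_col (matpoly_eval A x) = dim_col A"
  "i < dim_row A \<Longrightarrow> j < dim_col A \<Longrightarrow> matpoly_eval A x $$ (i, j) = poly (A $$ (i, j)) x"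
  by (simp_all add: matpoly_eval_def)

lemma matpoly_eval_add:
  assumes "A \<in> carrier_mat k l" "C \<in> carrier_mat k l"
  shows "matpoly_eval (A + C) x = matpoly_eval A x + matpoly_eval C x"
  using assms by (auto simp: matpoly_eval_def mat_eq_iff)

lemma matpoly_eval_mult:
  fixes A :: "'a::comm_ring_1 poly mat"
  assumes "A \<in> carrier_mat k l" "C \<in> carrier_mat l r"
  shows "matpoly_eval (A * C) x = matpoly_eval A x * matpoly_eval C x"
proof -
  interpret comm_ring_hom "\<lambda>p. poly p x" by unfold_locales auto
  show ?thesis unfolding matpoly_eval_def by (rule mat_hom_mult[OF assms])
qed

lemma matpoly_eval_mat_prod_list:
  fixes B :: "'b \<Rightarrow> 'a::comm_ring_1 poly mat"
  assumes "\<And>i. i \<in> set xs \<Longrightarrow> B i \<in> carrier_mat m m"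
  shows "matpoly_eval (mat_prod_list m (map B xs)) x =
    mat_prod_list m (map (\<lambda>i. matpoly_eval (B i) x) xs)"
  using assms
proof (induction xs)
  case Nil
  show ?case by (auto simp: mat_prod_list_def matpoly_eval_def mat_eq_iff)
next
  case (Cons y ys)
  then have "B y \<in> carrier_mat m m" "mat_prod_list m (map B ys) \<in> carrier_mat m m"
    by (auto intro!: mat_prod_list_carrier)
  from matpoly_eval_mult[OF this] show ?case using Cons by (simp add: mat_prod_list_def)
qed

lemma matpoly_eval_finsum:
  fixes A :: "'b \<Rightarrow> 'a::comm_ring_1 poly mat"
  assumes "finite F" "\<And>i. i \<in> F \<Longrightarrow> A i \<in> carrier_mat m m"
  shows "matpoly_eval (\<Oplus>\<^bsub>ring_mat TYPE('a poly) m ()\<^esub>i\<in>F. A i) x =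
    (\<Oplus>\<^bsub>ring_mat TYPE('a) m ()\<^esub>i\<in>F. matpoly_eval (A i) x)"
  using assms
proof (induction F)
  case empty
  interpret P: ring "ring_mat TYPE('a poly) m ()" by (rule ring_mat)
  interpret M: ring "ring_mat TYPE('a) m ()" by (rule ring_mat)
  show ?case by (auto simp: ring_mat_simps matpoly_eval_def mat_eq_iff)
next
  case (insert y F)
  interpret P: ring "ring_mat TYPE('a poly) m ()" by (rule ring_mat)
  interpret M: ring "ring_mat TYPE('a) m ()" by (rule ring_mat)
  let ?S = "\<Oplus>\<^bsub>ring_mat TYPE('a poly) m ()\<^esub>i\<in>F. A i"
  have A: "A \<in> F \<rightarrow> carrier (ring_mat TYPE('a poly) m ())" "A y \<in> carrier (ring_mat TYPE('a poly) m ())"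
    and A_eval: "(\<lambda>i. matpoly_eval (A i) x) \<in> F \<rightarrow> carrier (ring_mat TYPE('a) m ())"
      "matpoly_eval (A y) x \<in> carrier (ring_mat TYPE('a) m ())"
    using insert.prems by (auto simp: ring_mat_simps)
  have S: "?S \<in> carrier_mat m m" using P.finsum_closed[OF A(1)] by (simp add: ring_mat_simps)
  have "(\<Oplus>\<^bsub>ring_mat TYPE('a poly) m ()\<^esub>i\<in>insert y F. A i) = A y + ?S"
    using P.finsum_insert[OF insert.hyps A] by (simp add: ring_mat_simps)
  then show ?case
    using insert M.finsum_insert[OF insert.hyps A_eval] matpoly_eval_add[OF _ S, of "A y"]
    by (simp add: ring_mat_simps)
qed

lemma matpoly_eval_interpolation:
  fixes B W :: "'b \<Rightarrow> 'a::comm_ring_1 poly mat"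
  assumes B: "\<And>i. i \<in> set xs \<Longrightarrow> B i \<in> carrier_mat m m"
    and W: "\<And>i. i \<in> set xs \<Longrightarrow> W i \<in> carrier_mat m m"
  shows "matpoly_eval (mat_prod_list m (map B xs) +
      (\<Oplus>\<^bsub>ring_mat TYPE('a poly) m ()\<^esub>i\<in>set xs.
        W i * mat_prod_list m (map B (filter (\<lambda>j. j \<noteq> i) xs)))) x =
    mat_prod_list m (map (\<lambda>i. matpoly_eval (B i) x) xs) +
      (\<Oplus>\<^bsub>ring_mat TYPE('a) m ()\<^esub>i\<in>set xs. matpoly_eval (W i) x *
        mat_prod_list m (map (\<lambda>i. matpoly_eval (B i) x) (filter (\<lambda>j. j \<noteq> i) xs)))"
proof -
  interpret R: ring "ring_mat TYPE('a poly) m ()" by (rule ring_mat)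
  interpret M: ring "ring_mat TYPE('a) m ()" by (rule ring_mat)
  let ?C = "\<lambda>i. mat_prod_list m (map B (filter (\<lambda>j. j \<noteq> i) xs))"
  let ?D = "\<lambda>i. mat_prod_list m (map (\<lambda>i. matpoly_eval (B i) x) (filter (\<lambda>j. j \<noteq> i) xs))"
  let ?S = "\<Oplus>\<^bsub>ring_mat TYPE('a poly) m ()\<^esub>i\<in>set xs. W i * ?C i"
  have Q: "mat_prod_list m (map B xs) \<in> carrier_mat m m"
    by (rule mat_prod_list_carrier) (rule B)
  have Q_eval: "matpoly_eval (mat_prod_list m (map B xs)) x =
      mat_prod_list m (map (\<lambda>i. matpoly_eval (B i) x) xs)"
    by (rule matpoly_eval_mat_prod_list) (rule B)
  have C: "?C i \<in> carrier_mat m m" for i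
    by (rule mat_prod_list_carrier) (use B in auto)
  have C_eval: "matpoly_eval (?C i) x = ?D i" for i
    by (rule matpoly_eval_mat_prod_list) (use B in auto)
  have WC: "W i * ?C i \<in> carrier_mat m m" if "i \<in> set xs" for i
    by (rule mult_carrier_mat[OF W[OF that] C])
  have WC_eval: "matpoly_eval (W i * ?C i) x = matpoly_eval (W i) x * ?D i" if "i \<in> set xs" for i
    using matpoly_eval_mult[OF W[OF that] C] C_eval by simp
  have S: "?S \<in> carrier_mat m m"
    using R.finsum_closed[of "\<lambda>i. W i * ?C i" "set xs"] WC by (auto simp: ring_mat_simps)
  have "matpoly_eval ?S x = (\<Oplus>\<^bsub>ring_mat TYPE('a) m ()\<^esub>i\<in>set xs. matpoly_eval (W i * ?C i) x)"
    by (rule matpoly_eval_finsum) (use WC in auto)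
  also have "\<dots> = (\<Oplus>\<^bsub>ring_mat TYPE('a) m ()\<^esub>i\<in>set xs. matpoly_eval (W i) x * ?D i)"
  proof (rule M.finsum_cong')
    show "(\<lambda>i. matpoly_eval (W i) x * ?D i) \<in> set xs \<rightarrow> carrier (ring_mat TYPE('a) m ())"
      using WC unfolding ring_mat_simps
      by (intro Pi_I) (simp only: WC_eval[symmetric] matpoly_eval_carrier)
  qed (use WC_eval in simp_all)
  finally show ?thesis unfolding matpoly_eval_add[OF Q S] Q_eval by (rule arg_cong)
qed

lemma matpoly_eval_diag_block:
  fixes As :: "'a::comm_ring_1 poly mat list"
  shows "matpoly_eval (diag_block_mat As) x = diag_block_mat (map (\<lambda>A. matpoly_eval A x) As)"
proof (induction As)
  case (Cons A As)
  let ?D = "diag_block_mat As"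
  have dims: "dim_row (diag_block_mat (map (\<lambda>A. matpoly_eval A x) As)) = dim_row ?D"
    "dim_col (diag_block_mat (map (\<lambda>A. matpoly_eval A x) As)) = dim_col ?D"
    unfolding Cons.IH[symmetric] by simp_all
  show ?case by (intro eq_matI) (auto simp: Let_def dims simp flip: Cons.IH)
qed (auto simp: matpoly_eval_def)

lemma matpoly_eval_block_row:
  fixes A :: "'b \<Rightarrow> 'a::comm_ring_1 poly mat"
  assumes "\<And>i. i \<in> set xs \<Longrightarrow> A i \<in> carrier_mat r m"
  shows "matpoly_eval (block_row r (map A xs)) x =
    block_row r (map (\<lambda>i. matpoly_eval (A i) x) xs)"
  using assms
proof (induction xs)
  case (Cons y ys)
  let ?R = "block_row r (map A ys)"
  have "A y \<in> carrier_mat r m" "?R \<in> carrier_mat r (m * length ys)"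
    using Cons.prems by (auto intro!: block_row_carrier)
  then have "matpoly_eval (append_cols (A y) ?R) x =
      append_cols (matpoly_eval (A y) x) (matpoly_eval ?R x)"
    unfolding append_cols_def by (intro eq_matI) auto
  then show ?case using Cons by (simp add: block_row_def)
qed (auto simp: matpoly_eval_def block_row_def)

lemma matpoly_eval_kronecker_ones:
  "matpoly_eval (mat_kronecker (mat k 1 (\<lambda>_. 1)) (1\<^sub>m m) :: 'a::comm_ring_1 poly mat) x =
    mat_kronecker (mat k 1 (\<lambda>_. 1)) (1\<^sub>m m)"
proof (rule eq_matI)
  fix i j
  let ?K = "mat_kronecker (mat k 1 (\<lambda>_. 1)) (1\<^sub>m m) :: 'a mat"
  assume "i < dim_row ?K" "j < dim_col ?K"
  then have "i < k * m" "j < m" by (auto simp: mat_kronecker_def)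
  moreover from this have "m > 0" "i div m < k" by (auto simp: less_mult_imp_div_less)
  ultimately show "matpoly_eval (mat_kronecker (mat k 1 (\<lambda>_. 1)) (1\<^sub>m m)) x $$ (i, j) = ?K $$ (i, j)"
    by (simp add: matpoly_eval_def mat_kronecker_def)
qed (auto simp: matpoly_eval_def mat_kronecker_def)

lemma matpoly_eval_secular:
  fixes B W :: "nat \<Rightarrow> 'a::comm_ring_1 poly mat"
  assumes B: "\<And>i. i \<in> {1..q} \<Longrightarrow> B i \<in> carrier_mat m m"
    and W: "\<And>i. i \<in> {1..q} \<Longrightarrow> W i \<in> carrier_mat m m"
  shows "matpoly_eval (secular_matpoly m q B W) x =
    diag_block_mat (map (\<lambda>i. matpoly_eval (B i) x) [1..<Suc q]) +
    mat_kronecker (mat q 1 (\<lambda>_. 1)) (1\<^sub>m m) * block_row m (map (\<lambda>i. matpoly_eval (W i) x) [1..<Suc q])"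
proof -
  have len: "length [1..<Suc q] = q" by simp
  have D: "diag_block_mat (map B [1..<Suc q]) \<in> carrier_mat (m * q) (m * q)"
    using diag_block_carrier[of "[1..<Suc q]" B m] B unfolding len by (auto simp del: upt_Suc)
  have R: "block_row m (map W [1..<Suc q]) \<in> carrier_mat m (m * q)"
    using block_row_carrier[of "[1..<Suc q]" W m m] W unfolding len by (auto simp del: upt_Suc)
  show ?thesis
    unfolding secular_matpoly_def
      matpoly_eval_add[OF D mult_carrier_mat[OF kronecker_ones_carrier R]]
      matpoly_eval_mult[OF kronecker_ones_carrier R]
      matpoly_eval_diag_block matpoly_eval_kronecker_ones
    using matpoly_eval_block_row[of "[1..<Suc q]" W m m x] W
    by (simp add: comp_def del: upt_Suc)
qed

section \<open>Left eigenvectors of the secular matrix polynomial\<close>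

theorem theorem3p2:
  fixes m n q :: nat
    and P :: "complex poly mat"
    and B W :: "nat \<Rightarrow> complex poly mat"
    and l :: complex
  assumes P: "P \<in> carrier_mat m m"
    and P_regular: "matpoly_regular P"
    and P_degree: "matpoly_has_degree P n"
    and q: "0 < q" "q \<le> n"
    and B: "\<And>i. i \<in> {1..q} \<Longrightarrow> B i \<in> carrier_mat m m"
    and W: "\<And>i. i \<in> {1..q} \<Longrightarrow> W i \<in> carrier_mat m m"
    and P_eq: "P = mat_prod_list m (map B [1..<Suc q]) +
        (\<Oplus>\<^bsub>ring_mat TYPE(complex poly) m ()\<^esub>i\<in>{1..q}.
           W i * mat_prod_list m (map B (filter (\<lambda>j. j \<noteq> i) [1..<Suc q])))"
    and B_regular: "\<And>i. i \<in> {1..q} \<Longrightarrow> matpoly_regular (B i)"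
    and B_commute: "\<And>i j. i \<in> {1..q} \<Longrightarrow> j \<in> {1..q} \<Longrightarrow> B i * B j = B j * B i"
    and B_coprime: "\<And>i j. i \<in> {1..q} \<Longrightarrow> j \<in> {1..q} \<Longrightarrow> i \<noteq> j \<Longrightarrow> right_coprime m (B i) (B j)"
    and det_P: "det (matpoly_eval P l) = 0"
    and det_B: "\<And>i. i \<in> {1..q} \<Longrightarrow> det (matpoly_eval (B i) l) \<noteq> 0"
  shows
    "(\<forall>uA \<in> carrier_vec (m * q). \<forall>v.
        (\<forall>i \<in> {1..q}. v i \<in> carrier_vec m) \<longrightarrow>
        uA = vec_concat (map v [1..<Suc q]) \<longrightarrow>
        mat_of_row uA * matpoly_eval (secular_matpoly m q B W) l = 0\<^sub>m 1 (m * q) \<longrightarrow>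
        uA \<noteq> 0\<^sub>v (m * q) \<longrightarrow>
        (let u = finsum_vec TYPE(complex) m v {1..q} in
           u \<noteq> 0\<^sub>v m \<and> mat_of_row u * matpoly_eval P l = 0\<^sub>m 1 m)) \<and>
     (\<forall>u \<in> carrier_vec m.
        u \<noteq> 0\<^sub>v m \<longrightarrow>
        mat_of_row u * matpoly_eval P l = 0\<^sub>m 1 m \<longrightarrow>
        (let v = (\<lambda>i. row (- (mat_of_row u * matpoly_eval (W i) l *
                               the (mat_inverse (matpoly_eval (B i) l)))) 0);
             uA = vec_concat (map v [1..<Suc q]) in
           uA \<in> carrier_vec (m * q) \<and> uA \<noteq> 0\<^sub>v (m * q) \<and>
           mat_of_row uA * matpoly_eval (secular_matpoly m q B W) l = 0\<^sub>m 1 (m * q)))"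
proof -
  let ?xs = "[1..<Suc q]"
  let ?B = "\<lambda>i. matpoly_eval (B i) l" and ?W = "\<lambda>i. matpoly_eval (W i) l"
  let ?Q = "mat_prod_list m (map ?B ?xs)"
  let ?A = "matpoly_eval (secular_matpoly m q B W) l"
  have xs: "set ?xs = {1..q}" "distinct ?xs" "length ?xs = q" by auto
  have Bl: "\<And>i. i \<in> set ?xs \<Longrightarrow> ?B i \<in> carrier_mat m m"
    and Wl: "\<And>i. i \<in> set ?xs \<Longrightarrow> ?W i \<in> carrier_mat m m"
    using B W unfolding xs by auto
  have comm: "?B i * ?B j = ?B j * ?B i" if "i \<in> set ?xs" "j \<in> set ?xs" for i j
    using that B_commute[of i j] matpoly_eval_mult[OF B B, of i j l] matpoly_eval_mult[OF B B, of j i l]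
    unfolding xs by simp
  have det_Bl: "det (?B i) \<noteq> 0" if "i \<in> set ?xs" for i
    using that det_B unfolding xs(1) by blast
  have Q: "?Q \<in> carrier_mat m m" by (rule mat_prod_list_carrier) (rule Bl)
  have det_Q: "det ?Q \<noteq> 0"
    using det_mat_prod_list[of ?xs ?B m] Bl det_B xs(1) by (auto simp: prod_list_zero_iff simp del: upt_Suc)
  have P_l: "matpoly_eval P l = ?Q + (\<Oplus>\<^bsub>ring_mat TYPE(complex) m ()\<^esub>i\<in>set ?xs.
      ?W i * mat_prod_list m (map ?B (filter (\<lambda>j. j \<noteq> i) ?xs)))"
    unfolding P_eq xs(1)[symmetric]
    by (rule matpoly_eval_interpolation) (use B W xs(1) in auto)
  have A_l: "?A = diag_block_mat (map ?B ?xs) +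
      mat_kronecker (mat q 1 (\<lambda>_. 1)) (1\<^sub>m m) * block_row m (map ?W ?xs)"
    by (rule matpoly_eval_secular) (use B W in auto)
  have A_zero_iff: "mat_of_row (vec_concat (map v ?xs)) * ?A = 0\<^sub>m 1 (m * q) \<longleftrightarrow>
      (\<forall>i\<in>set ?xs. mat_of_row (v i) * ?B i =
        - (mat_of_row (finsum_vec TYPE(complex) m v {1..q}) * ?W i))"
    if "\<And>i. i \<in> set ?xs \<Longrightarrow> v i \<in> carrier_vec m" for v
    using row_mult_secular_eq_zero_iff[where v = v and m = m and B = ?B and W = ?W, OF xs(2) that Bl Wl]
    unfolding xs(1,3) A_l by (simp del: upt_Suc)
  have P_row: "mat_of_row u * matpoly_eval P l =
      mat_of_row (u - finsum_vec TYPE(complex) m v {1..q}) * ?Q"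
    if "u \<in> carrier_vec m" "\<And>i. i \<in> set ?xs \<Longrightarrow> v i \<in> carrier_vec m"
      "\<And>i. i \<in> set ?xs \<Longrightarrow> mat_of_row (v i) * ?B i = - (mat_of_row u * ?W i)" for u v
    using row_mult_interpolation[where v = v and m = m and B = ?B and W = ?W,
        OF xs(2) that(1,2) Bl Wl comm that(3)]
    unfolding P_l xs(1) .
  show ?thesis
  proof (intro conjI ballI allI impI)
    fix uA :: "complex vec" and v :: "nat \<Rightarrow> complex vec"
    assume v: "\<forall>i\<in>{1..q}. v i \<in> carrier_vec m" and uA: "uA = vec_concat (map v ?xs)"
      and zero: "mat_of_row uA * ?A = 0\<^sub>m 1 (m * q)" and nonzero: "uA \<noteq> 0\<^sub>v (m * q)"
    define u where "u = finsum_vec TYPE(complex) m v {1..q}"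
    have v': "\<And>i. i \<in> set ?xs \<Longrightarrow> v i \<in> carrier_vec m" using v xs by auto
    have u: "u \<in> carrier_vec m" unfolding u_def using v by (auto intro!: finsum_vec_closed)
    have eq: "mat_of_row (v i) * ?B i = - (mat_of_row u * ?W i)" if "i \<in> set ?xs" for i
      using zero that A_zero_iff[where v = v] v' unfolding uA u_def by blast
    \<comment> \<open>With \<open>u = 0\<close> the block equations reduce to \<open>v\<^sub>i\<^sup>t B\<^sub>i = 0\<close> with \<open>B\<^sub>i\<close> invertible.\<close>
    have "u \<noteq> 0\<^sub>v m"
    proof
      assume u0: "u = 0\<^sub>v m"
      have "v i = 0\<^sub>v m" if i: "i \<in> set ?xs" for i
      proof -
        have U0: "mat_of_row u = 0\<^sub>m 1 m" using mat_of_row_zero_iff[OF u] u0 by simp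
        have "mat_of_row (v i) * ?B i = 0\<^sub>m 1 m"
          unfolding eq[OF i] U0 using Wl[OF i] by (auto simp: mat_eq_iff)
        with mult_mat_eq_zero_det[OF Bl[OF i] det_Bl[OF i] mat_of_row_carrier(1)[OF v'[OF i]]]
        have "mat_of_row (v i) = 0\<^sub>m 1 m" by blast
        then show ?thesis using mat_of_row_zero_iff[OF v'[OF i]] by simp
      qed
      then show False using nonzero vec_concat_zero[of ?xs v m] unfolding uA xs(3) by blast
    qed
    moreover have "mat_of_row u * matpoly_eval P l = 0\<^sub>m 1 m"
    proof -
      have "u - finsum_vec TYPE(complex) m v {1..q} = 0\<^sub>v m"
        unfolding u_def[symmetric] using u by auto
      moreover have "mat_of_row (0\<^sub>v m) = (0\<^sub>m 1 m :: complex mat)"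
        using mat_of_row_zero_iff[of "0\<^sub>v m" m] by simp
      ultimately show ?thesis using P_row[where v = v, OF u v' eq] Q by simp
    qed
    ultimately show "let u = finsum_vec TYPE(complex) m v {1..q} in
        u \<noteq> 0\<^sub>v m \<and> mat_of_row u * matpoly_eval P l = 0\<^sub>m 1 m"
      unfolding u_def Let_def by blast
  next
    fix u :: "complex vec"
    assume u: "u \<in> carrier_vec m" and u0: "u \<noteq> 0\<^sub>v m"
      and uP: "mat_of_row u * matpoly_eval P l = 0\<^sub>m 1 m"
    define v where "v = (\<lambda>i. row (- (mat_of_row u * ?W i * the (mat_inverse (?B i)))) 0)"
    let ?s = "finsum_vec TYPE(complex) m v {1..q}"
    have U: "mat_of_row u \<in> carrier_mat 1 m" using u by auto
    have inv: "the (mat_inverse (?B i)) * ?B i = 1\<^sub>m m" "the (mat_inverse (?B i)) \<in> carrier_mat m m"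
      if "i \<in> set ?xs" for i
      using mat_inverse_det[OF Bl[OF that]] det_B that unfolding xs(1) by auto
    have UW: "mat_of_row u * ?W i \<in> carrier_mat 1 m" if "i \<in> set ?xs" for i
      by (rule mult_carrier_mat[OF U Wl[OF that]])
    have UWB: "- (mat_of_row u * ?W i * the (mat_inverse (?B i))) \<in> carrier_mat 1 m"
      if "i \<in> set ?xs" for i
      using mult_carrier_mat[OF UW[OF that] inv(2)[OF that]] by simp
    have v: "v i \<in> carrier_vec m" if "i \<in> set ?xs" for i
      unfolding v_def using UWB[OF that] by (intro row_carrier_vec) auto
    have eq: "mat_of_row (v i) * ?B i = - (mat_of_row u * ?W i)" if i: "i \<in> set ?xs" for i
    proof -
      have "mat_of_row (v i) = - (mat_of_row u * ?W i * the (mat_inverse (?B i)))"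
        unfolding v_def by (rule mat_of_row_row[OF UWB[OF i]])
      also have "\<dots> * ?B i = - (mat_of_row u * ?W i * the (mat_inverse (?B i)) * ?B i)"
        using inv(2)[OF i] Bl[OF i] by (intro uminus_mult_left_mat) auto
      also have "mat_of_row u * ?W i * the (mat_inverse (?B i)) * ?B i = mat_of_row u * ?W i"
        unfolding assoc_mult_mat[OF UW[OF i] inv(2)[OF i] Bl[OF i]] inv(1)[OF i]
        by (rule right_mult_one_mat[OF UW[OF i]])
      finally show ?thesis .
    qed
    have s: "?s \<in> carrier_vec m" using v unfolding xs by (auto intro!: finsum_vec_closed)
    have us: "u - ?s \<in> carrier_vec m" using u s by auto
    \<comment> \<open>So far the block equations hold for \<open>u\<close>, which must be identified with the sum of the blocks.\<close>
    have "mat_of_row (u - ?s) * ?Q = 0\<^sub>m 1 m"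
      using P_row[where v = v, OF u v eq] uP by simp
    then have "mat_of_row (u - ?s) = 0\<^sub>m 1 m"
      by (rule mult_mat_eq_zero_det[OF Q det_Q mat_of_row_carrier(1)[OF us]])
    then have "u - ?s = 0\<^sub>v m" using mat_of_row_zero_iff[OF us] by simp
    then have sum: "?s = u" using u s by (auto simp: vec_eq_iff)
    have carrier: "vec_concat (map v ?xs) \<in> carrier_vec (m * q)"
      using vec_concat_carrier[of ?xs v m] v unfolding xs(3) .
    have zero: "mat_of_row (vec_concat (map v ?xs)) * ?A = 0\<^sub>m 1 (m * q)"
      using A_zero_iff[where v = v] v eq unfolding sum by blast
    \<comment> \<open>The sum of the blocks is a linear image of the stacked vector, hence zero if the latter is.\<close>
    have "vec_concat (map v ?xs) \<noteq> 0\<^sub>v (m * q)"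
    proof
      assume 0: "vec_concat (map v ?xs) = 0\<^sub>v (m * q)"
      have "mat_of_row u = 0\<^sub>m 1 m"
        using row_mult_kronecker_ones[where v = v and m = m, OF xs(2) v]
          left_mult_zero_mat[OF kronecker_ones_carrier[of q m, where ?'a = complex], of 1]
          mat_of_row_zero_iff[of "0\<^sub>v (m * q) :: complex vec" "m * q"]
        unfolding xs(1,3) sum 0 by simp
      then show False using u0 mat_of_row_zero_iff[OF u] by simp
    qed
    with carrier zero show "let v = (\<lambda>i. row (- (mat_of_row u * ?W i * the (mat_inverse (?B i)))) 0);
          uA = vec_concat (map v ?xs) in
        uA \<in> carrier_vec (m * q) \<and> uA \<noteq> 0\<^sub>v (m * q) \<and> mat_of_row uA * ?A = 0\<^sub>m 1 (m * q)"
      unfolding v_def[symmetric] Let_def by blast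
  qed
qed

end
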